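(* Let $L$ and $B$ be commuting matrix ordinary differential operators in $\mathcal{R}_\ell[D]$, with $L=A_0+A_1D$ of order one and invertible leading coefficient $A_1$. Let $f=\mathrm{DRes}(L-\lambda,B-\mu)\in C[\lambda,\mu]$ and let $\Gamma=\{(\lambda,\mu)\in C^2\mid f(\lambda,\mu)=0\}$. Assume that $\Gamma$ is an irreducible plane algebraic curve, so that $f=h^\sigma$ with $h\in C[\lambda,\mu]$ irreducible, and that $f(L,B)=\mathbf{0}$. Then $\mathtt{BC}(L,B)=(h^r)$ for a positive integer $r$, minimal such that $h(L,B)^r=\mathbf{0}$, with $1\le r\le\sigma$. Moreover, $$C[L,B]\simeq\frac{C[\lambda,\mu]}{(h^r)}.$$ If in addition $f$ is irreducible in $C[\lambda,\mu]$, the algebra $C[L,B]$ is an integral domain whose maximal spectrum is isomorphic to $\Gamma$.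
   Context: $K$ is a differential field with derivation $\partial$ (write $a'=\partial(a)$) whose field of constants $C$ is algebraically closed of characteristic zero. $\mathcal{R}_\ell=M_\ell(K)$, with entrywise derivation $D(A)=A'$. $\mathcal{R}_\ell[D]$ is the ring of matrix ordinary differential operators $\sum_j B_jD^j$, $B_j\in\mathcal{R}_\ell$, with commutation rule $DA=AD+A'$; $\mathbf{0}$ is its zero. $\lambda,\mu$ are algebraic variables over $K$ with $\partial\lambda=\partial\mu=0$. For $L=A_0+A_1D$ with $A_1$ invertible and $B=\sum_{j=0}^nB_jD^j$, $n\ge1$, put $N_\lambda=-A_1^{-1}(A_0-\lambda I_\ell)$, $p_0(N_\lambda)=I_\ell$, $p_j(N_\lambda)=p_{j-1}(N_\lambda)N_\lambda+(p_{j-1}(N_\lambda))'$ for $j\ge1$, $M(L-\lambda,B-\mu)=B_0-\mu I_\ell+\sum_{j=1}^nB_jp_j(N_\lambda)$, and $\mathrm{DRes}(L-\lambda,B-\mu)=\det M(L-\lambda,B-\mu)$. When $L$ and $B$ commute this is a polynomial in $C[\lambda,\mu]$. "$\Gamma$ irreducible" means that $f$ has a unique irreducible factor (up to units), possibly with multiplicity. For commuting $L,B$ and $g=\sum a_{i,j}\lambda^i\mu^j\in C[\lambda,\mu]$, $g(L,B)=\sum a_{i,j}L^iB^j\in\mathcal{R}_\ell[D]$; $C[L,B]=\{g(L,B)\mid g\in C[\lambda,\mu]\}$ is a commutative subalgebra of $\mathcal{R}_\ell[D]$. The Burchnall-Chaundy ideal is $\mathtt{BC}(L,B)=\{g\in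 C[\lambda,\mu]\mid g(L,B)=\mathbf{0}\}$. *)

theory Defs
  imports
    "HOL-Analysis.Analysis"
    "HOL-Computational_Algebra.Computational_Algebra"
    "HOL-Algebra.QuotRing"
begin

class differential_ring = comm_ring_1 +
  fixes der :: "'a \<Rightarrow> 'a"
  assumes der_add: "der (a + b) = der a + der b"
    and der_mult: "der (a * b) = der a * b + a * der b"
begin

lemma der_0 [simp]: "der 0 = 0"
  using der_add[of 0 0] by simp

lemma der_1 [simp]: "der 1 = 0"
  using der_mult[of 1 1] by simp

lemma der_minus: "der (- a) = - der a"
  using der_add[of a "- a"] by (simp add: eq_neg_iff_add_eq_0 add.commute)

lemma der_diff: "der (a - b) = der a - der b"
  using der_add[of a "- b"] by (simp add: der_minus)

lemma der_sum: "der (sum f A) = (\<Sum>x\<in>A. der (f x))"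
  by (induction A rule: infinite_finite_induct) (simp_all add: der_add)

end

class differential_field = Fields.field + differential_ring

text \<open>Coefficientwise derivation of polynomials: the indeterminate has derivative zero.\<close>

instantiation poly :: (differential_ring) differential_ring
begin

definition der_poly :: "'a poly \<Rightarrow> 'a poly" where
  "der_poly = map_poly der"

instance
proof
  fix p q :: "'a poly"
  show "der (p + q) = der p + der q"
    by (rule poly_eqI) (simp add: der_poly_def coeff_map_poly der_add)
  show "der (p * q) = der p * q + p * der q"
    by (rule poly_eqI)
      (simp add: der_poly_def coeff_map_poly coeff_mult der_sum der_mult sum.distrib)
qed

end

typedef (overloaded) 'a constants = "{a :: 'a :: differential_field. der a = 0}"
  morphisms of_constant Abs_constants
  by (rule exI[of _ 0]) simp

setup_lifting type_definition_constants

instantiation constants :: (differential_field) "Fields.field"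
begin

lift_definition zero_constants :: "'a constants" is 0 by simp
lift_definition one_constants :: "'a constants" is 1 by simp
lift_definition plus_constants :: "'a constants \<Rightarrow> 'a constants \<Rightarrow> 'a constants" is "(+)"
  by (simp add: der_add)
lift_definition minus_constants :: "'a constants \<Rightarrow> 'a constants \<Rightarrow> 'a constants" is "(-)"
  by (simp add: der_diff)
lift_definition uminus_constants :: "'a constants \<Rightarrow> 'a constants" is uminus
  by (simp add: der_minus)
lift_definition times_constants :: "'a constants \<Rightarrow> 'a constants \<Rightarrow> 'a constants" is "(*)"
  by (simp add: der_mult)
lift_definition inverse_constants :: "'a constants \<Rightarrow> 'a constants" is inverse
proof -
  fix a :: 'a
  assume a: "der a = 0"
  show "der (inverse a) = 0"
  proof (cases "a = 0")
    case False
    have "a * der (inverse a) = der (a * inverse a)"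
      by (simp add: der_mult a)
    also have "\<dots> = 0"
      using False by simp
    finally show ?thesis
      using False by simp
  qed simp
qed
definition divide_constants :: "'a constants \<Rightarrow> 'a constants \<Rightarrow> 'a constants" where
  "divide_constants a b = a * inverse b"

instance
  by standard (transfer; simp add: algebra_simps; fail | simp add: divide_constants_def; fail)+

end

definition mat_der :: "'a::differential_ring^'n^'m \<Rightarrow> 'a^'n^'m" where
  "mat_der A = (\<chi> i j. der (A $ i $ j))"

lemma mat_der_add: "mat_der (A + B) = mat_der A + mat_der B"
  by (simp add: mat_der_def vec_eq_iff der_add)

lemma mat_der_0 [simp]: "mat_der 0 = 0"
  by (simp add: mat_der_def vec_eq_iff)

lemma mat_der_1 [simp]: "mat_der (mat 1) = 0"
  by (simp add: mat_der_def vec_eq_iff mat_def)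

lemma mat_der_mult: "mat_der (A ** B) = mat_der A ** B + A ** mat_der B"
  by (simp add: mat_der_def vec_eq_iff matrix_matrix_mult_def der_sum der_mult sum.distrib)

lemma mat_mult_0 [simp]:
  "(0 :: 'a::semiring_1^'n^'m) ** (B :: 'a^'k^'n) = 0"
  "(A :: 'a::semiring_1^'n^'m) ** (0 :: 'a^'k^'n) = 0"
  by (simp_all add: vec_eq_iff matrix_matrix_mult_def)

lemma mat_mult_add:
  "(A :: 'a::semiring_1^'n^'m) ** (B + C :: 'a^'k^'n) = A ** B + A ** C"
  "(A' + A :: 'a::semiring_1^'n^'m) ** (B :: 'a^'k^'n) = A' ** B + A ** B"
  by (simp_all add: vec_eq_iff matrix_matrix_mult_def algebra_simps sum.distrib)

text \<open>
  An operator is stored as the polynomial with coefficients \<open>B\<^sub>j\<close>, written to the left of the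
  powers of \<open>D\<close>. Only the additive structure is inherited from polynomials;
  left multiplication by \<open>D\<close> follows the rule \<open>D A = A D + A'\<close>.
\<close>

definition lmat :: "'a::differential_ring^'n^'n \<Rightarrow> ('a^'n^'n) poly \<Rightarrow> ('a^'n^'n) poly" where
  "lmat A Q = map_poly (\<lambda>B. A ** B) Q"

definition left_D :: "('a::differential_ring^'n^'n) poly \<Rightarrow> ('a^'n^'n) poly" where
  "left_D Q = pCons 0 Q + map_poly mat_der Q"

definition op_mult ::
  "('a::differential_ring^'n^'n) poly \<Rightarrow> ('a^'n^'n) poly \<Rightarrow> ('a^'n^'n) poly" where
  "op_mult P Q = (\<Sum>i\<le>degree P. lmat (coeff P i) ((left_D ^^ i) Q))"

lemma coeff_lmat: "coeff (lmat A Q) k = A ** coeff Q k"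
  by (simp add: lmat_def coeff_map_poly)

lemma coeff_left_D:
  "coeff (left_D Q) k = (case k of 0 \<Rightarrow> 0 | Suc j \<Rightarrow> coeff Q j) + mat_der (coeff Q k)"
  by (simp add: left_D_def coeff_map_poly coeff_pCons)

lemma lmat_add: "lmat A (P + Q) = lmat A P + lmat A Q"
  and lmat_add_left: "lmat (A + B) P = lmat A P + lmat B P"
  and lmat_lmat: "lmat A (lmat B P) = lmat (A ** B) P"
  and lmat_0 [simp]: "lmat A 0 = 0"
  and lmat_0_left [simp]: "lmat 0 P = 0"
  and lmat_1_left [simp]: "lmat (mat 1) P = P"
  by (simp_all add: poly_eq_iff coeff_lmat mat_mult_add matrix_mul_assoc)

lemma lmat_sum: "lmat A (sum f S) = (\<Sum>x\<in>S. lmat A (f x))"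
  by (induction S rule: infinite_finite_induct) (simp_all add: lmat_add)

lemma left_D_add: "left_D (P + Q) = left_D P + left_D Q"
  by (simp add: poly_eq_iff coeff_left_D mat_der_add split: nat.split)

lemma left_D_0 [simp]: "left_D 0 = 0"
  by (simp add: left_D_def)

lemma left_D_sum: "left_D (sum f S) = (\<Sum>x\<in>S. left_D (f x))"
  by (induction S rule: infinite_finite_induct) (simp_all add: left_D_add)

lemma left_D_lmat: "left_D (lmat A Q) = lmat A (left_D Q) + lmat (mat_der A) Q"
  by (simp add: poly_eq_iff coeff_left_D coeff_lmat mat_der_mult mat_mult_add split: nat.split)

lemma left_D_pow_add: "(left_D ^^ i) (P + Q) = (left_D ^^ i) P + (left_D ^^ i) Q"
  by (induction i) (simp_all add: left_D_add)

lemma left_D_pow_0 [simp]: "(left_D ^^ i) 0 = 0"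
  by (induction i) simp_all

lemma op_mult_bound:
  assumes "degree P \<le> n"
  shows "op_mult P Q = (\<Sum>i\<le>n. lmat (coeff P i) ((left_D ^^ i) Q))"
  unfolding op_mult_def
  by (rule sum.mono_neutral_left) (use assms in \<open>auto simp: coeff_eq_0\<close>)

lemma op_mult_add_left: "op_mult (P + Q) R = op_mult P R + op_mult Q R"
proof -
  let ?n = "max (degree P) (degree Q)"
  have "degree (P + Q) \<le> ?n"
    by (rule degree_add_le_max)
  then show ?thesis
    by (simp add: op_mult_bound[where n = ?n] lmat_add_left sum.distrib)
qed

lemma op_mult_add_right: "op_mult P (Q + R) = op_mult P Q + op_mult P R"
  by (simp add: op_mult_def left_D_pow_add lmat_add sum.distrib)

lemma op_mult_0 [simp]: "op_mult 0 Q = 0" "op_mult P 0 = 0"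
  by (simp_all add: op_mult_def)

lemma op_mult_sum_left: "op_mult (sum f S) R = (\<Sum>x\<in>S. op_mult (f x) R)"
  by (induction S rule: infinite_finite_induct) (simp_all add: op_mult_add_left)

lemma op_mult_lmat: "op_mult (lmat A Q) R = lmat A (op_mult Q R)"
proof -
  have "degree (lmat A Q) \<le> degree Q"
    by (rule degree_le) (simp add: coeff_lmat coeff_eq_0)
  then show ?thesis
    by (simp add: op_mult_bound[where n = "degree Q"] coeff_lmat lmat_sum lmat_lmat)
qed

lemma op_mult_left_D: "op_mult (left_D Q) R = left_D (op_mult Q R)"
proof -
  let ?n = "degree Q"
  have 1: "op_mult (pCons 0 Q) R = (\<Sum>i\<le>?n. lmat (coeff Q i) ((left_D ^^ Suc i) R))"
    by (simp add: op_mult_bound[where n = "Suc ?n"] degree_pCons_le sum.atMost_Suc_shift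
        del: sum.atMost_Suc)
  have "degree (map_poly mat_der Q) \<le> ?n"
    by (rule degree_le) (simp add: coeff_map_poly coeff_eq_0)
  then have 2: "op_mult (map_poly mat_der Q) R
      = (\<Sum>i\<le>?n. lmat (mat_der (coeff Q i)) ((left_D ^^ i) R))"
    by (simp add: op_mult_bound[where n = ?n] coeff_map_poly)
  show ?thesis
    unfolding left_D_def[of Q] op_mult_add_left 1 2
    by (simp add: op_mult_def left_D_sum left_D_lmat sum.distrib)
qed

lemma op_mult_left_D_pow: "op_mult ((left_D ^^ i) Q) R = (left_D ^^ i) (op_mult Q R)"
  by (induction i) (simp_all add: op_mult_left_D)

lemma op_mult_assoc: "op_mult (op_mult P Q) R = op_mult P (op_mult Q R)"
proof -
  have "op_mult (op_mult P Q) R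
      = (\<Sum>i\<le>degree P. op_mult (lmat (coeff P i) ((left_D ^^ i) Q)) R)"
    by (simp only: op_mult_def[of P Q] op_mult_sum_left)
  also have "\<dots> = op_mult P (op_mult Q R)"
    by (simp add: op_mult_def[of P] op_mult_lmat op_mult_left_D_pow)
  finally show ?thesis .
qed

lemma left_D_pow_1: "(left_D ^^ i) [:mat 1:] = monom (mat 1) i"
proof (induction i)
  case (Suc i)
  have "map_poly mat_der (monom (mat 1) i) = 0"
    by (simp add: poly_eq_iff coeff_map_poly coeff_monom)
  with Suc show ?case
    by (simp add: left_D_def monom_Suc)
qed (simp add: monom_0)

lemma op_mult_1_left: "op_mult [:mat 1:] Q = Q"
  by (simp add: op_mult_def)

lemma lmat_monom: "lmat A (monom (mat 1) i) = monom A i"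
  by (auto simp add: poly_eq_iff coeff_lmat coeff_monom)

lemma op_mult_1_right: "op_mult P [:mat 1:] = P"
  by (simp add: op_mult_def left_D_pow_1 lmat_monom poly_as_sum_of_monoms)

typedef (overloaded) ('a, 'n) diff_op = "UNIV :: ('a::differential_ring^'n::finite^'n) poly set"
  morphisms op_poly Abs_diff_op
  by simp

setup_lifting type_definition_diff_op

instantiation diff_op :: (differential_ring, finite) ring_1
begin

lift_definition zero_diff_op :: "('a, 'b) diff_op" is 0 .
lift_definition one_diff_op :: "('a, 'b) diff_op" is "[:mat 1:]" .
lift_definition plus_diff_op :: "('a, 'b) diff_op \<Rightarrow> ('a, 'b) diff_op \<Rightarrow> ('a, 'b) diff_op"
  is "(+)" .
lift_definition minus_diff_op :: "('a, 'b) diff_op \<Rightarrow> ('a, 'b) diff_op \<Rightarrow> ('a, 'b) diff_op"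
  is "(-)" .
lift_definition uminus_diff_op :: "('a, 'b) diff_op \<Rightarrow> ('a, 'b) diff_op" is uminus .
lift_definition times_diff_op :: "('a, 'b) diff_op \<Rightarrow> ('a, 'b) diff_op \<Rightarrow> ('a, 'b) diff_op"
  is op_mult .

instance
proof
  fix a b c :: "('a, 'b) diff_op"
  show "a * b * c = a * (b * c)" by transfer (rule op_mult_assoc)
  show "1 * a = a" by transfer (rule op_mult_1_left)
  show "a * 1 = a" by transfer (rule op_mult_1_right)
  show "(a + b) * c = a * c + b * c" by transfer (rule op_mult_add_left)
  show "a * (b + c) = a * b + a * c" by transfer (rule op_mult_add_right)
  have "[:mat 1:] \<noteq> (0 :: ('a^'b^'b) poly)"
    by (simp add: vec_eq_iff mat_def)
  then show "(0 :: ('a, 'b) diff_op) \<noteq> 1"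
    by transfer simp
qed (transfer; simp)+

end

lift_definition op_mat :: "'a::differential_ring^'n^'n \<Rightarrow> ('a, 'n::finite) diff_op" is "\<lambda>A. [:A:]" .

lift_definition op_D :: "('a::differential_ring, 'n::finite) diff_op" is "monom (mat 1) 1" .

lift_definition op_coeff :: "('a::differential_ring, 'n::finite) diff_op \<Rightarrow> nat \<Rightarrow> 'a^'n^'n" is coeff .

lift_definition op_order :: "('a::differential_ring, 'n::finite) diff_op \<Rightarrow> nat" is degree .

lemma op_D_mult: "op_D * op_mat A = op_mat A * op_D + op_mat (mat_der A)"
proof transfer
  fix A :: "'a^'b^'b"
  have 1: "op_mult (monom (mat 1) 1) Q = left_D Q" for Q :: "('a^'b^'b) poly"
    by (simp add: op_mult_bound[where n = 1] degree_monom_le coeff_monom)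
  have 2: "op_mult [:A:] (monom (mat 1) 1) = monom A 1"
    by (simp add: op_mult_def lmat_monom)
  show "op_mult (monom (mat 1) 1) [:A:] = op_mult [:A:] (monom (mat 1) 1) + [:mat_der A:]"
    unfolding 1 2
    by (auto simp: poly_eq_iff coeff_left_D coeff_monom coeff_pCons split: nat.splits)
qed

lemma op_expand: "P = (\<Sum>j\<le>op_order P. op_mat (op_coeff P j) * op_D ^ j)"
proof -
  have D: "op_poly (op_D ^ j :: ('a, 'b) diff_op) = monom (mat 1) j" for j
  proof (induction j)
    case (Suc j)
    have "op_mult (monom (mat 1) 1) Q = left_D Q" for Q :: "('a^'b^'b) poly"
      by (simp add: op_mult_bound[where n = 1] degree_monom_le coeff_monom)
    with Suc show ?case
      by (simp add: times_diff_op.rep_eq op_D.rep_eq flip: left_D_pow_1)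
  qed (simp add: one_diff_op.rep_eq monom_0)
  have S: "op_poly (sum f S) = (\<Sum>x\<in>S. op_poly (f x :: ('a, 'b) diff_op))" for f and S :: "nat set"
    by (induction S rule: infinite_finite_induct)
      (simp_all add: zero_diff_op.rep_eq plus_diff_op.rep_eq)
  have "op_mult [:A:] (monom (mat 1) j) = monom A j" for A :: "'a^'b^'b" and j
    by (simp add: op_mult_def lmat_monom)
  then have "op_poly (\<Sum>j\<le>op_order P. op_mat (op_coeff P j) * op_D ^ j) = op_poly P"
    by (simp add: S times_diff_op.rep_eq op_mat.rep_eq D op_coeff.rep_eq op_order.rep_eq
        poly_as_sum_of_monoms)
  then show ?thesis
    by (simp add: op_poly_inject)
qed

text \<open>
  The type \<open>'a poly poly\<close> renders the polynomials in \<open>\<lambda>, \<mu>\<close>: the coefficient of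
  \<open>\<lambda>\<^sup>i \<mu>\<^sup>j\<close> in \<open>g\<close> is \<open>coeff (coeff g j) i\<close>.
\<close>

definition var_lambda :: "'a::comm_ring_1 poly poly" where
  "var_lambda = [:[:0, 1:]:]"

definition var_mu :: "'a::comm_ring_1 poly poly" where
  "var_mu = [:0, 1:]"

definition mat_lift :: "'a::comm_ring_1^'n^'m \<Rightarrow> ('a poly poly)^'n^'m" where
  "mat_lift A = (\<chi> i j. [:[:A $ i $ j:]:])"

fun riccati_poly :: "'a::differential_ring^'n^'n \<Rightarrow> nat \<Rightarrow> 'a^'n^'n" where
  "riccati_poly N 0 = mat 1"
| "riccati_poly N (Suc j) = riccati_poly N j ** N + mat_der (riccati_poly N j)"

definition N_lambda ::
  "('a::differential_field, 'n::finite) diff_op \<Rightarrow> ('a poly poly)^'n^'n" where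
  "N_lambda L =
     - (mat_lift (matrix_inv (op_coeff L 1)) ** (mat_lift (op_coeff L 0) - mat var_lambda))"

definition res_matrix ::
  "('a::differential_field, 'n::finite) diff_op \<Rightarrow> ('a, 'n) diff_op \<Rightarrow> ('a poly poly)^'n^'n" where
  "res_matrix L B = mat_lift (op_coeff B 0) - mat var_mu
     + (\<Sum>j = 1..op_order B. mat_lift (op_coeff B j) ** riccati_poly (N_lambda L) j)"

definition DRes ::
  "('a::differential_field, 'n::finite) diff_op \<Rightarrow> ('a, 'n) diff_op \<Rightarrow> 'a poly poly" where
  "DRes L B = det (res_matrix L B)"

definition curve :: "'c::comm_ring_1 poly poly \<Rightarrow> ('c \<times> 'c) set" where
  "curve f = {(a, b). poly (poly f [:b:]) a = 0}"

text \<open>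
  Irreducibility of the curve counted with multiplicity: one irreducible factor up to units, with any
  multiplicity. This is not irreducibility of the polynomial \<open>f\<close>.
\<close>

definition irreducible_curve :: "'c::comm_ring_1 poly poly \<Rightarrow> bool" where
  "irreducible_curve f \<longleftrightarrow>
     (\<exists>p. irreducible p \<and> p dvd f \<and> (\<forall>q. irreducible q \<and> q dvd f \<longrightarrow> q dvd p \<and> p dvd q))"

definition op_const :: "'a::differential_field constants \<Rightarrow> ('a, 'n::finite) diff_op" where
  "op_const c = op_mat (mat (of_constant c))"

definition op_eval ::
  "('a::differential_field, 'n::finite) diff_op \<Rightarrow> ('a, 'n) diff_op
     \<Rightarrow> 'a constants poly poly \<Rightarrow> ('a, 'n) diff_op" where
  "op_eval L B g =
     (\<Sum>j\<le>degree g. \<Sum>i\<le>degree (coeff g j). op_const (coeff (coeff g j) i) * L ^ i * B ^ j)"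

definition BC :: "('a::differential_field, 'n::finite) diff_op \<Rightarrow> ('a, 'n) diff_op
     \<Rightarrow> 'a constants poly poly set" where
  "BC L B = {g. op_eval L B g = 0}"

definition poly_ring2 :: "'c::comm_ring_1 poly poly ring" where
  "poly_ring2 = \<lparr>carrier = UNIV, mult = (*), one = 1, zero = 0, add = (+)\<rparr>"

definition gen_algebra ::
  "('a::differential_field, 'n::finite) diff_op \<Rightarrow> ('a, 'n) diff_op \<Rightarrow> ('a, 'n) diff_op ring" where
  "gen_algebra L B =
     \<lparr>carrier = range (op_eval L B), mult = (*), one = 1, zero = 0, add = (+)\<rparr>"

text \<open>
  A \<open>C\<close>-algebra is a ring together with a structure map \<open>\<epsilon>\<close> from \<open>C\<close>.
\<close>

definition algebra_isomorphic ::
  "('r, 'm) ring_scheme \<Rightarrow> ('c \<Rightarrow> 'r) \<Rightarrow> ('s, 'k) ring_scheme \<Rightarrow> ('c \<Rightarrow> 's) \<Rightarrow> bool" where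
  "algebra_isomorphic R \<epsilon> S \<eta> \<longleftrightarrow> (\<exists>\<phi> \<in> ring_iso R S. \<forall>c. \<phi> (\<epsilon> c) = \<eta> c)"

definition max_spectrum :: "('r, 'm) ring_scheme \<Rightarrow> 'r set set" where
  "max_spectrum R = {m. maximalideal m R}"

definition zariski_max_spectrum :: "('r, 'm) ring_scheme \<Rightarrow> 'r set topology" where
  "zariski_max_spectrum R =
     topology_generated_by ((\<lambda>a. {m \<in> max_spectrum R. a \<notin> m}) ` carrier R)"

text \<open>
  The value of \<open>a\<close> at the maximal ideal \<open>m\<close> is its class in \<open>R/m\<close>. For a finitely generated algebra
  over an algebraically closed \<open>C\<close> this residue field is \<open>C\<close>, so the description is proper.
\<close>

definition value_at :: "('r, 'm) ring_scheme \<Rightarrow> ('c \<Rightarrow> 'r) \<Rightarrow> 'r set \<Rightarrow> 'r \<Rightarrow> 'c" where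
  "value_at R \<epsilon> m a = (THE c. a \<ominus>\<^bsub>R\<^esub> \<epsilon> c \<in> m)"

definition zariski_curve :: "'c::comm_ring_1 poly poly \<Rightarrow> ('c \<times> 'c) topology" where
  "zariski_curve f =
     topology_generated_by (range (\<lambda>g. {(a, b) \<in> curve f. poly (poly g [:b:]) a \<noteq> 0}))"

text \<open>
  Isomorphism of affine varieties: a homeomorphism of the Zariski topologies that identifies
  the rings of regular functions (both sides seen as functions on the curve).
\<close>

definition curve_isomorphic_max_spectrum ::
  "'c::comm_ring_1 poly poly \<Rightarrow> ('r, 'm) ring_scheme \<Rightarrow> ('c \<Rightarrow> 'r) \<Rightarrow> bool" where
  "curve_isomorphic_max_spectrum f R \<epsilon> \<longleftrightarrow>
     (\<exists>\<Phi>. homeomorphic_map (zariski_curve f) (zariski_max_spectrum R) \<Phi> \<and>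
        (\<lambda>a. \<lambda>x\<in>curve f. value_at R \<epsilon> (\<Phi> x) a) ` carrier R =
        range (\<lambda>g. \<lambda>x\<in>curve f. poly (poly g [:snd x:]) (fst x)))"

end

theory Submission
  imports Defs "HOL-Computational_Algebra.Field_as_Ring"
begin

text \<open>
  Let \<open>r\<close> be least with
  \<open>h(L,B)\<^sup>r = 0\<close>. A polynomial prime to \<open>h\<close> generates together with \<open>h\<close> some nonzero \<open>c(\<lambda>)\<close>,
  and \<open>c(L)\<close> is not a zero divisor because \<open>L\<close> has order one with invertible leading
  coefficient; hence \<open>g(L,B) = 0\<close> forces \<open>h\<^sup>r\<close> to divide \<open>g\<close>. The same elimination of \<open>\<mu>\<close> replaces
  the Nullstellensatz in the description of the maximal ideals of \<open>C[\<lambda>,\<mu>]/(f)\<close>.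
\<close>

section \<open>Elimination in polynomials over a domain\<close>

text \<open>The operator ring has zero divisors in general, so neither \<open>h(L,B)\<close> nor the
  value of a polynomial prime to \<open>h\<close> can simply be cancelled; elimination is there to
  produce a value \<open>c(L)\<close> that can. It can because C is algebraically closed:
  \<open>c\<close> splits into linear factors, and every \<open>L - a\<close> is again of order one
  with leading coefficient \<open>A1\<close>. Elimination of \<mu> requires that \<open>h\<close>
  really involves \<mu>. This follows from f(L,B) = 0: for \<open>h = c(\<lambda>)\<close> no power
  of \<open>h(L,B)\<close> would vanish. The quotient and the spectrum are treated for an arbitrary
  ring homomorphism \<open>E\<close> on C[\<lambda>,\<mu>], since only its kernel matters there. For
  irreducible \<open>f\<close> one takes \<sigma> = 1, which forces r = 1 and makes the kernel the
  prime ideal \<open>(f)\<close>.\<close>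

instantiation constants :: (differential_field)
  "{unique_euclidean_ring, normalization_euclidean_semiring, normalization_semidom_multiplicative}"
begin

definition [simp]: "normalize_constants = (normalize_field :: 'a constants \<Rightarrow> _)"
definition [simp]: "unit_factor_constants = (unit_factor_field :: 'a constants \<Rightarrow> _)"
definition [simp]: "modulo_constants = (mod_field :: 'a constants \<Rightarrow> _)"
definition [simp]: "euclidean_size_constants = (euclidean_size_field :: 'a constants \<Rightarrow> _)"
definition [simp]: "division_segment (x :: 'a constants) = 1"

instance
  by standard (simp_all add: dvd_field_iff field_split_simps split: if_splits)

end

instantiation constants :: (differential_field) euclidean_ring_gcd
begin

definition gcd_constants :: "'a constants \<Rightarrow> 'a constants \<Rightarrow> 'a constants" where
  "gcd_constants = Euclidean_Algorithm.gcd"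
definition lcm_constants :: "'a constants \<Rightarrow> 'a constants \<Rightarrow> 'a constants" where
  "lcm_constants = Euclidean_Algorithm.lcm"
definition Gcd_constants :: "'a constants set \<Rightarrow> 'a constants" where
  "Gcd_constants = Euclidean_Algorithm.Gcd"
definition Lcm_constants :: "'a constants set \<Rightarrow> 'a constants" where
  "Lcm_constants = Euclidean_Algorithm.Lcm"

instance
  by standard (simp_all add: gcd_constants_def lcm_constants_def Gcd_constants_def Lcm_constants_def)

end

text \<open>With this, the polynomial instances make C[\<lambda>,\<mu>] factorial: irreducible
  elements become prime, and prime divisors are available.\<close>

instance constants :: (differential_field) field_gcd ..

text \<open>
  A nonzero element of least degree in the ideal \<open>(u, p)\<close> divides, up to factors from the
  coefficient ring, both \<open>p\<close> and \<open>u\<close>; primality of \<open>p\<close> then forces its degree to be zero.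
\<close>

lemma prime_elem_combination_const:
  fixes p u :: "'a::idom poly"
  assumes p: "prime_elem p" and deg: "degree p > 0" and u: "\<not> p dvd u"
  shows "\<exists>a b c. c \<noteq> 0 \<and> a * u + b * p = [:c:]"
proof -
  define I where "I = {a * u + b * p | a b. True}"
  have uI: "u \<in> I"
    unfolding I_def by (rule CollectI, rule exI[of _ 1], rule exI[of _ 0]) simp
  have pI: "p \<in> I"
    unfolding I_def by (rule CollectI, rule exI[of _ 0], rule exI[of _ 1]) simp
  \<comment> \<open>The shape of a pseudo-remainder, which takes the place of the remainder because
    the coefficients form only a domain.\<close>
  have I_comb: "smult c x - y * z \<in> I" if "x \<in> I" "y \<in> I" for c x y z
  proof -
    from that obtain a b a' b' where "x = a * u + b * p" "y = a' * u + b' * p"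
      unfolding I_def by blast
    then have "smult c x - y * z = (smult c a - a' * z) * u + (smult c b - b' * z) * p"
      by (simp add: algebra_simps smult_add_right)
    then show ?thesis
      unfolding I_def by blast
  qed
  have "p \<noteq> 0"
    using deg by auto
  with pI obtain d where d: "d \<in> I" "d \<noteq> 0" and min: "\<And>e. e \<in> I \<Longrightarrow> e \<noteq> 0 \<Longrightarrow> degree d \<le> degree e"
    using arg_min_nat_lemma[of "\<lambda>d. d \<in> I \<and> d \<noteq> 0" p degree] by auto
  have div: "\<exists>c q. c \<noteq> 0 \<and> smult c x = d * q" if x: "x \<in> I" for x
  proof -
    from pseudo_mod(1)[OF d(2), of x] obtain c q
      where c: "c \<noteq> 0" and eq: "smult c x = d * q + pseudo_mod x d"
      by blast
    then have "pseudo_mod x d = smult c x - d * q"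
      by simp
    then have "pseudo_mod x d \<in> I"
      using I_comb x d(1) by simp
    with pseudo_mod(2)[OF d(2), of x] min have "pseudo_mod x d = 0"
      by fastforce
    with c eq show ?thesis
      by auto
  qed
  from div[OF pI] obtain c q where c: "c \<noteq> 0" and q: "smult c p = d * q"
    by blast
  from div[OF uI] obtain c' q' where c': "c' \<noteq> 0" and q': "smult c' u = d * q'"
    by blast
  have "p dvd d * q"
    using q by (metis dvd_refl dvd_smult)
  then have "p dvd d \<or> p dvd q"
    using p prime_elem_dvd_mult_iff by blast
  moreover have "\<not> p dvd d"
  proof
    assume "p dvd d"
    then have "p dvd [:c':] * u"
      using q' by simp
    then have "p dvd [:c':]"
      using p u prime_elem_dvd_mult_iff by blast
    then have "degree p \<le> degree [:c':]"
      using c' by (intro dvd_imp_degree_le) auto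
    with deg show False
      by simp
  qed
  ultimately obtain k where k: "q = p * k"
    by blast
  then have "p * (d * k) = p * [:c:]"
    using q by (simp add: mult.left_commute)
  then have dk: "d * k = [:c:]"
    using \<open>p \<noteq> 0\<close> by (simp only: mult_cancel_left) simp
  then have "d \<noteq> 0" "k \<noteq> 0"
    using c by auto
  then have "degree d + degree k = 0"
    using dk degree_mult_eq[of d k] by simp
  then obtain e where e: "d = [:e:]"
    by (metis add_is_0 degree_eq_zeroE)
  with d show ?thesis
    unfolding I_def by auto metis
qed

text \<open>\<open>p\<close> splits into linear factors and \<open>Q\<close> descends to one of
  them; the condition on constants excludes that the descent ends in a constant. \<open>Q\<close>
  abstracts both membership in a prime ideal and the property that \<open>p(L)\<close> annihilates
  some nonzero operator.\<close>

lemma root_if_prime_property: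
  fixes Q :: "'c::field poly \<Rightarrow> bool"
  assumes closed: "\<And>p :: 'c poly. degree p > 0 \<Longrightarrow> \<exists>x. poly p x = 0"
    and Q_mult: "\<And>p q. Q (p * q) \<Longrightarrow> Q p \<or> Q q"
    and Q_const: "\<And>c. Q [:c:] \<Longrightarrow> c = 0"
    and "Q p" "p \<noteq> 0"
  shows "\<exists>a. Q [:- a, 1:]"
  using \<open>Q p\<close> \<open>p \<noteq> 0\<close>
proof (induction "degree p" arbitrary: p)
  case 0
  then show ?case
    using Q_const by (metis degree_eq_zeroE pCons_0_0)
next
  case (Suc n)
  then obtain a where "poly p a = 0"
    using closed by (metis zero_less_Suc)
  then obtain q where q: "p = [:- a, 1:] * q"
    by (auto simp: poly_eq_0_iff_dvd)
  then have "q \<noteq> 0"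
    using Suc.prems by auto
  then have "degree p = Suc (degree q)"
    unfolding q by (subst degree_mult_eq) auto
  then show ?case
    using Q_mult[of "[:- a, 1:]" q] Suc q \<open>q \<noteq> 0\<close> by auto
qed

section \<open>Evaluation of polynomials at commuting operators\<close>

text \<open>One variable at a time with a free coefficient map, so that it can be iterated:
  evaluation at \<open>B\<close> over evaluation at \<open>L\<close> is
  \<open>op_eval L B\<close>.\<close>

definition poly_eval :: "('c::zero \<Rightarrow> 's::ring_1) \<Rightarrow> 's \<Rightarrow> 'c poly \<Rightarrow> 's" where
  "poly_eval \<phi> x p = (\<Sum>i\<le>degree p. \<phi> (coeff p i) * x ^ i)"

locale poly_evaluation =
  fixes \<phi> :: "'c::comm_ring_1 \<Rightarrow> 's::ring_1" and x :: 's
  assumes hom_add: "\<phi> (a + b) = \<phi> a + \<phi> b"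
    and hom_mult: "\<phi> (a * b) = \<phi> a * \<phi> b"
    and hom_1: "\<phi> 1 = 1"
    and commutes: "x * \<phi> a = \<phi> a * x"
begin

lemma hom_0: "\<phi> 0 = 0"
  using hom_add[of 0 0] by simp

lemma eval_0 [simp]: "poly_eval \<phi> x 0 = 0"
  by (simp add: poly_eval_def hom_0)

lemma eval_pCons: "poly_eval \<phi> x (pCons a p) = \<phi> a + poly_eval \<phi> x p * x"
proof (cases "p = 0")
  case False
  then show ?thesis
    by (simp add: poly_eval_def sum.atMost_Suc_shift sum_distrib_right mult.assoc power_commutes
        del: sum.atMost_Suc)
qed (simp add: poly_eval_def hom_0)

lemma eval_const: "poly_eval \<phi> x [:a:] = \<phi> a"
  by (simp add: eval_pCons)

lemma eval_1: "poly_eval \<phi> x 1 = 1"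
  by (simp add: eval_const hom_1 flip: pCons_one)

lemma eval_add: "poly_eval \<phi> x (p + q) = poly_eval \<phi> x p + poly_eval \<phi> x q"
  by (induction p q rule: poly_induct2) (simp_all add: eval_pCons hom_add algebra_simps)

lemma eval_smult: "poly_eval \<phi> x (smult a p) = \<phi> a * poly_eval \<phi> x p"
  by (induction p) (simp_all add: eval_pCons hom_mult distrib_left mult.assoc)

text \<open>Needed twice: \<open>y = x\<close> gives multiplicativity in a noncommutative target,
  and \<open>y = B\<close> allows the second layer of evaluation.\<close>

lemma eval_commutes:
  assumes "\<And>a. y * \<phi> a = \<phi> a * y" "y * x = x * y"
  shows "y * poly_eval \<phi> x p = poly_eval \<phi> x p * y"
proof (induction p)
  case (pCons a p)
  have "y * poly_eval \<phi> x (pCons a p) = y * \<phi> a + (y * poly_eval \<phi> x p) * x"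
    by (simp add: eval_pCons algebra_simps)
  also have "\<dots> = \<phi> a * y + poly_eval \<phi> x p * (y * x)"
    by (simp add: assms(1) pCons.IH mult.assoc)
  also have "\<dots> = poly_eval \<phi> x (pCons a p) * y"
    by (simp add: eval_pCons algebra_simps assms(2))
  finally show ?case .
qed simp

lemma eval_mult: "poly_eval \<phi> x (p * q) = poly_eval \<phi> x p * poly_eval \<phi> x q"
proof (induction p)
  case (pCons a p)
  have "x * poly_eval \<phi> x q = poly_eval \<phi> x q * x"
    by (rule eval_commutes) (simp_all add: commutes)
  then show ?case
    by (simp add: eval_add eval_pCons eval_smult hom_0 pCons.IH algebra_simps)
qed simp

end

section \<open>Constants as central scalar operators\<close>

lemma op_const_add: "op_const (a + b) = op_const a + op_const b"
  unfolding op_const_def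
  by transfer (simp add: vec_eq_iff mat_def plus_constants.rep_eq)

lemma op_mat_mult: "op_mat A * op_mat B = op_mat (A ** B)"
  by transfer (simp add: op_mult_def poly_eq_iff coeff_lmat coeff_pCons split: nat.split)

lemma mat_mult_mat: "mat c ** A = (\<chi> i j. c * A $ i $ j)" "A ** mat c = (\<chi> i j. A $ i $ j * c)"
  for A :: "'a::comm_semiring_1^'n^'n"
  by (simp_all add: vec_eq_iff matrix_matrix_mult_def mat_def if_distrib if_distribR sum.delta cong: if_cong)

lemma op_const_mult:
  "op_const (a * b) = (op_const a * op_const b :: ('a::differential_field, 'b::finite) diff_op)"
proof -
  have "mat (of_constant (a * b)) = mat (of_constant a) ** (mat (of_constant b) :: 'a^'b^'b)"
    unfolding mat_mult_mat by (simp add: vec_eq_iff mat_def times_constants.rep_eq)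
  then show ?thesis
    by (simp add: op_const_def op_mat_mult)
qed

lemma op_const_1: "op_const 1 = 1"
  unfolding op_const_def one_constants.rep_eq by transfer simp

lemma op_const_commutes: "X * op_const c = op_const c * X"
proof -
  \<comment> \<open>This removes the correction term \<open>A'\<close> from
    \<open>D A = A D + A'\<close>.\<close>
  have der: "mat_der (mat (of_constant c)) = 0"
    using of_constant[of c] by (simp add: mat_der_def mat_def vec_eq_iff)
  have D: "op_D * op_const c = op_const c * op_D"
    unfolding op_const_def op_D_mult der by transfer simp
  have A: "op_mat A * op_const c = op_const c * op_mat A" for A
    by (simp add: op_const_def op_mat_mult mat_mult_mat mult.commute)
  have Dj: "op_D ^ j * op_const c = op_const c * op_D ^ j" for j
    by (simp add: D power_commuting_commutes)
  have "op_mat A * op_D ^ j * op_const c = op_const c * (op_mat A * op_D ^ j)" for A j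
    by (metis A Dj mult.assoc)
  then have "(\<Sum>j\<le>op_order X. op_mat (op_coeff X j) * op_D ^ j) * op_const c
      = op_const c * (\<Sum>j\<le>op_order X. op_mat (op_coeff X j) * op_D ^ j)"
    unfolding sum_distrib_left sum_distrib_right by (intro sum.cong refl)
  then show ?thesis
    unfolding op_expand[of X, symmetric] .
qed

interpretation const_eval: poly_evaluation op_const L
  for L :: "('a::differential_field, 'n::finite) diff_op"
  by unfold_locales (rule op_const_add op_const_mult op_const_1 op_const_commutes)+

lemma op_eval_eq: "op_eval L B = poly_eval (poly_eval op_const L) B"
  by (simp add: fun_eq_iff op_eval_def poly_eval_def sum_distrib_right)

text \<open>If \<open>X\<close> has degree m, then in degree m + 1 only \<open>A1\<close> times the
  leading coefficient of \<open>X\<close> survives, since \<open>A0 X\<close> and the entrywise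
  derivative of \<open>X\<close> stop at degree m. Invertibility lets \<open>A1\<close> be
  cancelled; a nonzero matrix could still be a zero divisor.\<close>

lemma order_one_left_regular:
  fixes X :: "('a::differential_field, 'n::finite) diff_op"
  assumes "invertible A1" and "(op_mat A0 + op_mat A1 * op_D) * X = 0"
  shows "X = 0"
proof -
  have 1: "op_mult (monom (mat 1) 1) Q = left_D Q" for Q :: "('a^'n^'n) poly"
    by (simp add: op_mult_bound[where n = 1] degree_monom_le coeff_monom)
  have 2: "op_mult [:A:] Q = lmat A Q" for A :: "'a^'n^'n" and Q
    by (simp add: op_mult_def)
  have "op_mat A0 * X + op_mat A1 * (op_D * X) = 0"
    using assms(2) by (simp only: distrib_right mult.assoc)
  then have "op_poly (op_mat A0 * X + op_mat A1 * (op_D * X)) = 0"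
    by (simp only: zero_diff_op.rep_eq)
  then have eq: "lmat A0 (op_poly X) + lmat A1 (left_D (op_poly X)) = 0"
    by (simp only: plus_diff_op.rep_eq times_diff_op.rep_eq op_mat.rep_eq op_D.rep_eq 1 2)
  let ?m = "degree (op_poly X)"
  have "coeff (lmat A0 (op_poly X) + lmat A1 (left_D (op_poly X))) (Suc ?m) = 0"
    unfolding eq by simp
  moreover have "coeff (op_poly X) (Suc ?m) = 0"
    by (rule coeff_eq_0) simp
  ultimately have "A1 ** lead_coeff (op_poly X) = 0"
    by (simp add: coeff_lmat coeff_left_D)
  moreover obtain A' where "A' ** A1 = mat 1"
    using assms(1) invertible_def by blast
  ultimately have "lead_coeff (op_poly X) = 0"
    using matrix_mul_assoc[of A' A1 "lead_coeff (op_poly X)"] by simp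
  then show ?thesis
    using op_poly_inject[of X 0] by (simp add: zero_diff_op.rep_eq)
qed

text \<open>A zero divisor \<open>c(L)\<close> would yield a zero divisor \<open>L - a\<close>, but
  subtracting a scalar changes only \<open>A0\<close> and keeps the invertible
  \<open>A1\<close>.\<close>

lemma poly_order_one_left_regular:
  fixes X :: "('a::differential_field, 'n::finite) diff_op"
  assumes closed: "\<And>p :: 'a constants poly. degree p > 0 \<Longrightarrow> \<exists>x. poly p x = 0"
    and inv: "invertible A1" and L: "L = op_mat A0 + op_mat A1 * op_D"
    and "c \<noteq> 0" and "poly_eval op_const L c * X = 0"
  shows "X = 0"
proof -
  have linear: "X = 0" if "poly_eval op_const L [:- a, 1:] * X = 0" for a and X :: "('a, 'n) diff_op"
  proof -
    have "poly_eval op_const L [:- a, 1:] = op_mat (A0 + mat (of_constant (- a))) + op_mat A1 * op_D"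
      unfolding const_eval.eval_pCons const_eval.eval_0 op_const_1 L
      by (simp add: op_const_def) (transfer, simp)
    with that show ?thesis
      using order_one_left_regular[OF inv] by simp
  qed
  define Q where "Q c \<longleftrightarrow> (\<exists>X :: ('a, 'n) diff_op. X \<noteq> 0 \<and> poly_eval op_const L c * X = 0)" for c
  have "\<not> Q c"
  proof
    assume "Q c"
    have "\<exists>a. Q [:- a, 1:]"
    proof (rule root_if_prime_property[where Q = Q and p = c])
      fix p q
      assume "Q (p * q)"
      then obtain Y :: "('a, 'n) diff_op"
        where Y: "Y \<noteq> 0" "poly_eval op_const L p * (poly_eval op_const L q * Y) = 0"
        unfolding Q_def by (auto simp: const_eval.eval_mult mult.assoc)
      \<comment> \<open>Either \<open>q(L)\<close> kills \<open>Y\<close>, or \<open>q(L) Y\<close>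
        is a nonzero operator killed by \<open>p(L)\<close>.\<close>
      then show "Q p \<or> Q q"
        unfolding Q_def by (cases "poly_eval op_const L q * Y = 0") blast+
    next
      fix e :: "'a constants"
      assume "Q [:e:]"
      then obtain Y :: "('a, 'n) diff_op" where Y: "Y \<noteq> 0" "op_const e * Y = 0"
        unfolding Q_def const_eval.eval_const by blast
      have "e \<noteq> 0 \<Longrightarrow> Y = op_const (inverse e) * (op_const e * Y)"
        by (simp flip: mult.assoc op_const_mult add: op_const_1)
      with Y show "e = 0"
        by auto
    qed (use closed \<open>Q c\<close> \<open>c \<noteq> 0\<close> in auto)
    then show False
      using linear unfolding Q_def by blast
  qed
  then show ?thesis
    using assms(5) unfolding Q_def by blast
qed

section \<open>Images of the polynomial ring\<close>

definition range_ring :: "('a \<Rightarrow> 's::ring_1) \<Rightarrow> 's ring" where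
  "range_ring E = \<lparr>carrier = range E, mult = (*), one = 1, zero = 0, add = (+)\<rparr>"

lemma range_ring_simps [simp]:
  "carrier (range_ring E) = range E" "mult (range_ring E) = (*)" "one (range_ring E) = 1"
  "zero (range_ring E) = 0" "add (range_ring E) = (+)"
  by (simp_all add: range_ring_def)

lemma poly_ring2_simps [simp]:
  "carrier poly_ring2 = UNIV" "mult poly_ring2 = (*)" "one poly_ring2 = 1"
  "zero poly_ring2 = 0" "add poly_ring2 = (+)"
  by (simp_all add: poly_ring2_def)

lemma cring_poly_ring2: "cring (poly_ring2 :: 'c::comm_ring_1 poly poly ring)"
proof (rule cringI)
  show "abelian_group (poly_ring2 :: 'c poly poly ring)"
  proof (rule abelian_groupI)
    fix x :: "'c poly poly"
    show "\<exists>y\<in>carrier poly_ring2. y \<oplus>\<^bsub>poly_ring2\<^esub> x = \<zero>\<^bsub>poly_ring2\<^esub>"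
      by (rule bexI[of _ "- x"]) simp_all
  qed (simp_all add: ac_simps)
  show "Group.comm_monoid (poly_ring2 :: 'c poly poly ring)"
    by (rule comm_monoidI) (simp_all add: ac_simps)
qed (simp_all add: algebra_simps)

lemma cgenideal_poly_ring2: "PIdl\<^bsub>poly_ring2\<^esub> p = {g. p dvd g}"
  by (auto simp: cgenideal_def dvd_def mult.commute)

text \<open>The target may be noncommutative, as the operator ring is; the image of
  C[\<lambda>,\<mu>] is always commutative.\<close>

locale eval_ring =
  fixes E :: "'c::field poly poly \<Rightarrow> 's::ring_1"
  assumes E_add: "E (g + g') = E g + E g'"
    and E_mult: "E (g * g') = E g * E g'"
    and E_1: "E 1 = 1"
begin

lemma E_0: "E 0 = 0"
  using E_add[of 0 0] by simp

lemma E_minus: "E (- g) = - E g"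
  using E_add[of g "- g"] by (simp add: E_0 eq_neg_iff_add_eq_0 add.commute)

lemma E_diff: "E (g - g') = E g - E g'"
  using E_add[of g "- g'"] by (simp add: E_minus)

lemma E_power: "E (g ^ n) = E g ^ n"
  by (induction n) (simp_all add: E_1 E_mult)

lemma cring_range_ring: "cring (range_ring E)"
proof (rule cringI)
  show "abelian_group (range_ring E)"
  proof (rule abelian_groupI)
    fix x
    assume "x \<in> carrier (range_ring E)"
    then obtain g where "x = E g"
      by auto
    then show "\<exists>y\<in>carrier (range_ring E). y \<oplus>\<^bsub>range_ring E\<^esub> x = \<zero>\<^bsub>range_ring E\<^esub>"
      by (intro bexI[of _ "E (- g)"]) (simp add: E_minus, simp)
  qed (auto simp: ac_simps simp flip: E_add E_0)
  show "Group.comm_monoid (range_ring E)"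
    by (rule comm_monoidI) (auto simp: ac_simps simp flip: E_mult E_1)
qed (auto simp: algebra_simps)

lemma a_minus_range_ring:
  "a_minus (range_ring E) (E g) (E g') = E (g - g')"
proof -
  interpret cring "range_ring E"
    by (rule cring_range_ring)
  have "\<ominus>\<^bsub>range_ring E\<^esub> E g' = E (- g')"
    by (rule minus_equality) (simp_all flip: E_add add: E_0)
  then show ?thesis
    by (simp add: a_minus_def flip: E_add)
qed

lemma ring_hom_ring_E: "ring_hom_ring poly_ring2 (range_ring E) E"
  using cring.axioms(1)[OF cring_poly_ring2] cring.axioms(1)[OF cring_range_ring]
  by (rule ring_hom_ringI) (simp_all add: E_add E_mult E_1)

lemma algebra_isomorphic_quotient:
  assumes ker: "{g. E g = 0} = I"
  shows "algebra_isomorphic (range_ring E) (\<lambda>c. E [:[:c:]:])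
    (poly_ring2 Quot I) (\<lambda>c. I +>\<^bsub>poly_ring2\<^esub> [:[:c:]:])"
proof -
  interpret hom: ring_hom_ring poly_ring2 "range_ring E" E
    by (rule ring_hom_ring_E)
  let ?\<psi> = "\<lambda>X. the_elem (E ` X)"
  have I: "a_kernel poly_ring2 (range_ring E) E = I"
    unfolding a_kernel_def' using ker by simp
  have iso: "?\<psi> \<in> ring_iso (poly_ring2 Quot I) (range_ring E)"
    using hom.FactRing_iso_set I by simp
  have quot: "ring (poly_ring2 Quot I)"
    using hom.kernel_is_ideal I by (metis ideal.quotient_is_ring)
  \<comment> \<open>The homomorphism theorem gives the map out of the quotient. Compatibility with
    the structure maps needs the explicit values of its inverse.\<close>
  have "inv_into (carrier (poly_ring2 Quot I)) ?\<psi> (E g) = I +>\<^bsub>poly_ring2\<^esub> g" for g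
  proof (rule inv_into_f_eq)
    show "inj_on ?\<psi> (carrier (poly_ring2 Quot I))"
      using iso by (simp add: ring_iso_def bij_betw_def)
    show "I +>\<^bsub>poly_ring2\<^esub> g \<in> carrier (poly_ring2 Quot I)"
      by (auto simp: FactRing_def A_RCOSETS_def')
    show "?\<psi> (I +>\<^bsub>poly_ring2\<^esub> g) = E g"
      using hom.the_elem_simp[of g] I by simp
  qed
  then show ?thesis
    unfolding algebra_isomorphic_def
    using ring_iso_set_sym[OF quot iso] by blast
qed

end

section \<open>Maximal ideals of the coordinate ring of a plane curve\<close>

definition point_eval :: "'c::comm_ring_1 \<times> 'c \<Rightarrow> 'c poly poly \<Rightarrow> 'c" where
  "point_eval x g = poly (poly g [:snd x:]) (fst x)"

lemma point_eval_simps [simp]: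
  "point_eval x (g + g') = point_eval x g + point_eval x g'"
  "point_eval x (g - g') = point_eval x g - point_eval x g'"
  "point_eval x (g * g') = point_eval x g * point_eval x g'"
  "point_eval x 0 = 0" "point_eval x 1 = 1" "point_eval x [:[:c:]:] = c"
  by (simp_all add: point_eval_def)

lemma mem_curve_iff: "x \<in> curve f \<longleftrightarrow> point_eval x f = 0"
  by (simp add: curve_def point_eval_def case_prod_beta)

lemma point_eval_eq_0_if_dvd: "x \<in> curve f \<Longrightarrow> f dvd g \<Longrightarrow> point_eval x g = 0"
  by (auto simp: mem_curve_iff dvd_def)

text \<open>The two substitutions in the opposite order: \<lambda> first, in the coefficients, then
  \<mu>.\<close>

lemma poly_map_poly_eval: "poly (map_poly (\<lambda>q. poly q a) g) b = point_eval (a, b) g"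
  by (induction g) (simp_all add: point_eval_def map_poly_pCons)

text \<open>Division by \<mu> - b, then of the remainder by \<lambda> - a. An ideal containing both
  linear polynomials thus contains g - g(a,b).\<close>

lemma point_eval_decomp:
  "\<exists>u v. g = [:[:- a, 1:]:] * u + [:[:- b:], 1:] * v + [:[:point_eval (a, b) g:]:]"
proof -
  define p where "p = poly g [:b:]"
  have "[:- [:b:], 1:] dvd g - [:p:]"
    using poly_eq_0_iff_dvd[of "g - [:p:]" "[:b:]"] by (simp add: p_def)
  then obtain v where "g - [:p:] = [:- [:b:], 1:] * v" ..
  then have v: "g = [:[:- b:], 1:] * v + [:p:]"
    by (simp add: algebra_simps)
  have "[:- a, 1:] dvd p - [:poly p a:]"
    by (simp flip: poly_eq_0_iff_dvd)
  then obtain u where "p - [:poly p a:] = [:- a, 1:] * u" ..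
  then have "p = [:- a, 1:] * u + [:poly p a:]"
    by (simp add: algebra_simps)
  then have "[:p:] = [:[:- a, 1:] * u + [:poly p a:]:]"
    by (rule arg_cong)
  also have "\<dots> = [:[:- a, 1:]:] * [:u:] + [:[:poly p a:]:]"
    by simp
  finally have p: "[:p:] = [:[:- a, 1:]:] * [:u:] + [:[:poly p a:]:]" .
  have "g = [:[:- a, 1:]:] * [:u:] + [:[:- b:], 1:] * v + [:[:poly p a:]:]"
    using v unfolding p by (simp only: add_ac)
  moreover have "poly p a = point_eval (a, b) g"
    by (simp add: p_def point_eval_def)
  ultimately show ?thesis
    by (intro exI[of _ "[:u:]"] exI[of _ v]) (simp only:)
qed

lemma map_poly_eval_decomp:
  fixes g :: "'c::idom poly poly"
  shows "\<exists>u. g = [:[:- a, 1:]:] * u + map_poly (\<lambda>c. [:c:]) (map_poly (\<lambda>q. poly q a) g)"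
proof -
  have "[:[:- a, 1:]:] dvd g - map_poly (\<lambda>c. [:c:]) (map_poly (\<lambda>q. poly q a) g)"
    unfolding const_poly_dvd_iff poly_eq_0_iff_dvd[symmetric] by (simp add: coeff_map_poly)
  then obtain u where "g - map_poly (\<lambda>c. [:c:]) (map_poly (\<lambda>q. poly q a) g) = [:[:- a, 1:]:] * u" ..
  then have "g = [:[:- a, 1:]:] * u + map_poly (\<lambda>c. [:c:]) (map_poly (\<lambda>q. poly q a) g)"
    by (metis diff_add_cancel)
  then show ?thesis ..
qed

text \<open>The embedding of C[\<mu>] into C[\<lambda>,\<mu>]; multiplicativity lets the prime
  property of an ideal be pulled back along it.\<close>

lemma map_poly_const_mult:
  "map_poly (\<lambda>c. [:c:]) (p * q) = map_poly (\<lambda>c. [:c:]) p * map_poly (\<lambda>c. [:c:]) (q :: 'c::comm_ring_1 poly)"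
proof -
  have const_sum: "(\<Sum>x\<in>A. [:h x:]) = [:sum h A:]" for h :: "nat \<Rightarrow> 'c" and A
    by (induction A rule: infinite_finite_induct) simp_all
  show ?thesis
    by (rule poly_eqI) (simp add: coeff_map_poly coeff_mult const_sum mult.commute)
qed

text \<open>Continuity needs checking only on generators, and both the map and its inverse pull
  generators back to generators.\<close>

lemma homeomorphic_map_generated:
  assumes bij: "bij_betw \<Phi> (\<Union>\<S>) (\<Union>\<T>)" and \<T>: "\<T> = (`) \<Phi> ` \<S>"
  shows "homeomorphic_map (topology_generated_by \<S>) (topology_generated_by \<T>) \<Phi>"
proof -
  let ?\<Psi> = "inv_into (\<Union>\<S>) \<Phi>"
  have inj: "inj_on \<Phi> (\<Union>\<S>)" and im: "\<Phi> ` \<Union>\<S> = \<Union>\<T>"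
    using bij by (auto simp: bij_betw_def)
  have "\<Phi> -` (\<Phi> ` U) \<inter> \<Union>\<S> = U" if "U \<in> \<S>" for U
    using inj_on_image_mem_iff[OF inj] that by blast
  then have 1: "continuous_map (topology_generated_by \<S>) (topology_generated_by \<T>) \<Phi>"
    unfolding continuous_on_generated_topo_iff
    using im by (auto simp: \<T> topology_generated_by_Basis)
  have "inv_into A \<Phi> -` U \<inter> \<Phi> ` A = \<Phi> ` U" if "inj_on \<Phi> A" "U \<subseteq> A" for A U
    using that by auto
  then have "?\<Psi> -` U \<inter> \<Union>\<T> = \<Phi> ` U" if "U \<in> \<S>" for U
    unfolding im[symmetric] using that inj Union_upper by blast
  then have 2: "continuous_map (topology_generated_by \<T>) (topology_generated_by \<S>) ?\<Psi>"
    unfolding continuous_on_generated_topo_iff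
    using bij_betw_inv_into[OF bij] by (auto simp: \<T> topology_generated_by_Basis bij_betw_def)
  have "homeomorphic_maps (topology_generated_by \<S>) (topology_generated_by \<T>) \<Phi> ?\<Psi>"
    unfolding homeomorphic_maps_def topology_generated_by_topspace
    by (intro conjI ballI 1 2 inv_into_f_f[OF inj] bij_betw_inv_into_right[OF bij])
  then show ?thesis
    unfolding homeomorphic_map_maps by blast
qed

locale coordinate_ring = eval_ring E for E :: "'c::field poly poly \<Rightarrow> 's::ring_1" +
  fixes f :: "'c poly poly"
  assumes closed: "\<And>p :: 'c poly. degree p > 0 \<Longrightarrow> \<exists>x. poly p x = 0"
    and prime_f: "prime_elem f" and degree_f: "degree f > 0"
    and E_eq_0_iff: "E g = 0 \<longleftrightarrow> f dvd g"
begin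

lemma domain_range_ring: "domain (range_ring E)"
proof -
  interpret cring "range_ring E"
    by (rule cring_range_ring)
  show ?thesis
  proof
    have "E 1 \<noteq> 0"
      using prime_f unfolding E_eq_0_iff by (simp add: prime_elem_def)
    then show "\<one>\<^bsub>range_ring E\<^esub> \<noteq> \<zero>\<^bsub>range_ring E\<^esub>"
      by (simp add: E_1)
  next
    fix a b
    assume "a \<otimes>\<^bsub>range_ring E\<^esub> b = \<zero>\<^bsub>range_ring E\<^esub>"
      "a \<in> carrier (range_ring E)" "b \<in> carrier (range_ring E)"
    then obtain g g' where "a = E g" "b = E g'" "E (g * g') = 0"
      by (auto simp: E_mult)
    then show "a = \<zero>\<^bsub>range_ring E\<^esub> \<or> b = \<zero>\<^bsub>range_ring E\<^esub>"
      using prime_elem_dvd_multD[OF prime_f] by (simp add: E_eq_0_iff)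
  qed
qed

definition point_ideal :: "'c \<times> 'c \<Rightarrow> 's set" where
  "point_ideal x = E ` {g. point_eval x g = 0}"

text \<open>Two representatives of the same element differ by a multiple of \<open>f\<close>, which
  vanishes on the curve. Off the curve \<open>point_ideal x\<close> is the whole ring.\<close>

lemma E_mem_point_ideal_iff:
  assumes "x \<in> curve f"
  shows "E g \<in> point_ideal x \<longleftrightarrow> point_eval x g = 0"
proof
  assume "E g \<in> point_ideal x"
  then obtain g' where g': "point_eval x g' = 0" "E g = E g'"
    unfolding point_ideal_def by blast
  then have "f dvd g - g'"
    by (simp flip: E_eq_0_iff add: E_diff)
  then have "point_eval x (g - g') = 0"
    by (rule point_eval_eq_0_if_dvd[OF assms])
  with g' show "point_eval x g = 0"
    by simp
qed (auto simp: point_ideal_def)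

lemma ideal_point_ideal: "ideal (point_ideal x) (range_ring E)"
proof (rule idealI)
  interpret cring "range_ring E"
    by (rule cring_range_ring)
  show "ring (range_ring E)"
    by (rule ring_axioms)
  show "subgroup (point_ideal x) (add_monoid (range_ring E))"
  proof (rule add.subgroupI)
    show "point_ideal x \<noteq> {}"
      by (auto simp: point_ideal_def intro: exI[of _ 0])
  next
    fix a
    assume "a \<in> point_ideal x"
    then obtain g where g: "a = E g" "point_eval x g = 0"
      by (auto simp: point_ideal_def)
    have "\<ominus>\<^bsub>range_ring E\<^esub> E g = E (0 - g)"
      by (rule minus_equality) (simp_all flip: E_add add: E_0)
    then show "\<ominus>\<^bsub>range_ring E\<^esub> a \<in> point_ideal x"
      using g by (simp add: point_ideal_def del: diff_0)
  qed (auto simp: point_ideal_def simp flip: E_add)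
  fix a y
  assume "a \<in> point_ideal x" "y \<in> carrier (range_ring E)"
  then obtain g g' where "a = E g" "point_eval x g = 0" "y = E g'"
    by (auto simp: point_ideal_def)
  then show "y \<otimes>\<^bsub>range_ring E\<^esub> a \<in> point_ideal x" "a \<otimes>\<^bsub>range_ring E\<^esub> y \<in> point_ideal x"
    by (auto simp: point_ideal_def simp flip: E_mult)
qed

text \<open>The ideal has codimension one: an element with value \<open>c\<close> at
  \<open>x\<close> differs from the constant \<open>c\<close> by an element of the ideal, so
  adjoining it with \<open>c\<close> nonzero yields a unit.\<close>

lemma maximalideal_point_ideal:
  assumes x: "x \<in> curve f"
  shows "maximalideal (point_ideal x) (range_ring E)"
proof (rule maximalidealI)
  have "E 1 \<notin> point_ideal x"
    by (simp add: E_mem_point_ideal_iff[OF x])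
  then show "carrier (range_ring E) \<noteq> point_ideal x"
    by auto
next
  fix J
  assume J: "ideal J (range_ring E)" "point_ideal x \<subseteq> J" "J \<subseteq> carrier (range_ring E)"
  interpret J: ideal J "range_ring E"
    by (rule J)
  show "J = point_ideal x \<or> J = carrier (range_ring E)"
  proof (rule ccontr)
    assume neq: "\<not> ?thesis"
    then obtain g where g: "E g \<in> J" "E g \<notin> point_ideal x"
      using J(2,3) by auto
    define c where "c = point_eval x g"
    have c: "c \<noteq> 0"
      using g(2) by (simp add: E_mem_point_ideal_iff[OF x] c_def)
    have "E ([:[:c:]:] - g) \<in> J"
      using J(2) by (auto simp: point_ideal_def c_def)
    from additive_subgroup.a_closed[OF J.additive_subgroup_axioms this g(1)]
    have "E [:[:c:]:] \<in> J"
      by (simp add: E_diff)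
    then have "E [:[:inverse c:]:] * E [:[:c:]:] \<in> J"
      using J.I_l_closed[of "E [:[:c:]:]" "E [:[:inverse c:]:]"] by simp
    moreover have "[:[:inverse c:]:] * [:[:c:]:] = 1"
      using c by (simp flip: pCons_one)
    ultimately have "\<one>\<^bsub>range_ring E\<^esub> \<in> J"
      by (simp only: range_ring_simps E_1 flip: E_mult)
    then have "J = carrier (range_ring E)"
      by (rule J.one_imp_carrier)
    with neq show False
      by simp
  qed
qed (rule ideal_point_ideal)

text \<open>Specialising \<lambda> to a non-root of the leading coefficient keeps the degree in
  \<mu> positive, so a root in \<mu> exists.\<close>

lemma curve_nonempty: "curve f \<noteq> {}"
proof -
  have "\<exists>a. poly (lead_coeff f) a \<noteq> 0"
  proof (rule ccontr)
    assume zero: "\<not> ?thesis"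
    have "degree (lead_coeff f) \<noteq> 0"
    proof
      assume "degree (lead_coeff f) = 0"
      then obtain e where "lead_coeff f = [:e:]"
        by (metis degree_eq_zeroE)
      with zero have "lead_coeff f = 0"
        by simp
      with degree_f show False
        by simp
    qed
    \<comment> \<open>Under the assumption this nonconstant polynomial takes only the value 1, so it
      has no root.\<close>
    then have "degree (lead_coeff f + 1) > 0"
      by (subst degree_add_eq_left) simp_all
    then obtain a where "poly (lead_coeff f + 1) a = 0"
      using closed by blast
    with zero show False
      by simp
  qed
  then obtain a where a: "poly (lead_coeff f) a \<noteq> 0" ..
  have "coeff (map_poly (\<lambda>q. poly q a) f) (degree f) \<noteq> 0"
    using a by (simp add: coeff_map_poly)
  then have "degree (map_poly (\<lambda>q. poly q a) f) > 0"
    using degree_f le_degree by fastforce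
  then obtain b where "poly (map_poly (\<lambda>q. poly q a) f) b = 0"
    using closed by blast
  then show ?thesis
    by (auto simp: poly_map_poly_eval simp flip: mem_curve_iff)
qed

text \<open>
  A prime ideal strictly above \<open>(f)\<close> contains a nonzero polynomial in \<open>\<lambda>\<close> alone, hence some
  \<open>\<lambda> - a\<close>, and then, reducing \<open>f\<close> modulo \<open>\<lambda> - a\<close>, some \<open>\<mu> - b\<close>.
\<close>

lemma maximalideal_eq_point_ideal:
  assumes M: "maximalideal M (range_ring E)"
  shows "\<exists>x\<in>curve f. M = point_ideal x"
proof -
  interpret cring "range_ring E"
    by (rule cring_range_ring)
  interpret M: maximalideal M "range_ring E"
    by (rule M)
  interpret MP: primeideal M "range_ring E"
    by (rule maximalideal_prime[OF M])
  define P where "P = {g. E g \<in> M}"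
  have P_add: "g + g' \<in> P" if "g \<in> P" "g' \<in> P" for g g'
    using that additive_subgroup.a_closed[OF M.additive_subgroup_axioms] by (simp add: P_def E_add)
  have P_mult: "g * g' \<in> P" if "g \<in> P \<or> g' \<in> P" for g g'
    using that M.I_l_closed[of "E g'" "E g"] M.I_r_closed[of "E g" "E g'"]
    by (auto simp: P_def E_mult)
  have P_prime: "g \<in> P \<or> g' \<in> P" if "g * g' \<in> P" for g g'
    using that MP.I_prime[of "E g" "E g'"] by (simp add: P_def E_mult)
  have P_dvd: "g \<in> P" if "f dvd g" for g
    using that M.zero_closed by (simp add: P_def flip: E_eq_0_iff)
  have P_1: "1 \<notin> P"
    using M.one_imp_carrier M.I_notcarr by (auto simp: P_def E_1)
  have P_const: "c = 0" if "[:[:c:]:] \<in> P" for c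
  proof (rule ccontr)
    assume "c \<noteq> 0"
    then have "[:[:c:]:] * [:[:inverse c:]:] = 1"
      by (simp flip: pCons_one)
    then show False
      using P_mult[of "[:[:c:]:]" "[:[:inverse c:]:]"] that P_1 by simp
  qed
  have M_eq: "M = E ` P"
    using M.a_subset by (auto simp: P_def)
  have reduce: "\<exists>x\<in>curve f. M = point_ideal x" if "x \<in> curve f" "P \<subseteq> {g. point_eval x g = 0}" for x
  proof -
    have "M \<subseteq> point_ideal x"
      using that(2) by (auto simp: M_eq point_ideal_def)
    moreover have "E 1 \<notin> point_ideal x"
      by (simp add: E_mem_point_ideal_iff[OF that(1)])
    ultimately have "M = point_ideal x"
      using M.I_maximal[OF ideal_point_ideal[of x]] by (auto simp: point_ideal_def)
    with that(1) show ?thesis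
      by blast
  qed
  show ?thesis
  proof (cases "\<exists>g\<in>P. \<not> f dvd g")
    \<comment> \<open>Here P = (f), which is contained in the vanishing ideal of any point of the
      curve; maximality of \<open>M\<close> does the rest.\<close>
    case False
    obtain x where x: "x \<in> curve f"
      using curve_nonempty by blast
    have "point_eval x g = 0" if "g \<in> P" for g
      using False that point_eval_eq_0_if_dvd[OF x] by blast
    then show ?thesis
      using reduce[OF x] by blast
  next
    case True
    then obtain g where g: "g \<in> P" "\<not> f dvd g"
      by blast
    obtain u v c where c: "c \<noteq> 0" "u * g + v * f = [:c:]"
      using prime_elem_combination_const[OF prime_f degree_f g(2)] by blast
    have "[:c:] \<in> P"
      unfolding c(2)[symmetric] using g(1) P_add P_mult P_dvd by simp
    have "\<exists>a. [:[:- a, 1:]:] \<in> P"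
    proof (rule root_if_prime_property[where Q = "\<lambda>q. [:q:] \<in> P" and p = c])
      fix p q
      assume "[:p * q:] \<in> P"
      then show "[:p:] \<in> P \<or> [:q:] \<in> P"
        using P_prime[of "[:p:]" "[:q:]"] by (simp add: mult.commute)
    qed (use closed c(1) \<open>[:c:] \<in> P\<close> P_const in auto)
    then obtain a where a: "[:[:- a, 1:]:] \<in> P" ..
    let ?t = "map_poly (\<lambda>q. poly q a) f"
    obtain u where u: "f = [:[:- a, 1:]:] * u + map_poly (\<lambda>c. [:c:]) ?t"
      using map_poly_eval_decomp by blast
    have not_dvd: "\<not> f dvd [:[:- a, 1:]:]"
      using degree_f dvd_imp_degree_le[of f "[:[:- a, 1:]:]"] by auto
    \<comment> \<open>Otherwise \<lambda> - a divides the prime \<open>f\<close>. As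
      \<open>f\<close> does not divide \<lambda> - a, by the degree in \<mu>, the latter would be a
      unit, yet it lies in \<open>P\<close>.\<close>
    have "?t \<noteq> 0"
    proof
      assume "?t = 0"
      then have f: "f = [:[:- a, 1:]:] * u"
        using u by simp
      then have "f dvd u"
        using prime_elem_dvd_multD[OF prime_f, of "[:[:- a, 1:]:]" u] not_dvd by auto
      then obtain w where "u = f * w" ..
      with f have "f * ([:[:- a, 1:]:] * w) = f * 1"
        by (simp add: mult.left_commute)
      moreover have "f \<noteq> 0"
        using degree_f by auto
      ultimately have "[:[:- a, 1:]:] * w = 1"
        by (simp only: mult_cancel_left) simp
      then show False
        using P_mult[of "[:[:- a, 1:]:]" w] a P_1 by simp
    qed
    have "map_poly (\<lambda>c. [:c:]) ?t = f - [:[:- a, 1:]:] * u"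
      using u by (metis add_diff_cancel_left')
    also have "\<dots> = f * 1 + [:[:- a, 1:]:] * (- u)"
      by (simp only: mult_1_right mult_minus_right diff_conv_add_uminus)
    also have "\<dots> \<in> P"
      by (intro P_add; rule P_mult, rule disjI1, rule a P_dvd[OF dvd_refl])
    finally have t: "map_poly (\<lambda>c. [:c:]) ?t \<in> P" .
    have "\<exists>b. map_poly (\<lambda>c. [:c:]) [:- b, 1:] \<in> P"
    proof (rule root_if_prime_property[where Q = "\<lambda>q. map_poly (\<lambda>c. [:c:]) q \<in> P" and p = ?t])
      fix p q
      assume "map_poly (\<lambda>c. [:c:]) (p * q) \<in> P"
      then show "map_poly (\<lambda>c. [:c:]) p \<in> P \<or> map_poly (\<lambda>c. [:c:]) q \<in> P"
        using P_prime by (simp add: map_poly_const_mult)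
    next
      fix c :: 'c
      assume "map_poly (\<lambda>c. [:c:]) [:c:] \<in> P"
      then show "c = 0"
        using P_const by (simp add: map_poly_pCons)
    qed (use closed t \<open>?t \<noteq> 0\<close> in auto)
    then obtain b where b: "[:[:- b:], 1:] \<in> P"
      by (auto simp: map_poly_pCons simp flip: pCons_one)
    have P_ev: "point_eval (a, b) g = 0" if "g \<in> P" for g
    proof -
      have cancel: "Z = g + (- X + - Y)" if "g = X + Y + Z" for X Y Z
        using that by simp
      obtain u v where uv: "g = [:[:- a, 1:]:] * u + [:[:- b:], 1:] * v + [:[:point_eval (a, b) g:]:]"
        using point_eval_decomp[of g a b] by blast
      have "[:[:point_eval (a, b) g:]:]
          = g * 1 + ([:[:- a, 1:]:] * (- u) + [:[:- b:], 1:] * (- v))"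
        using cancel[OF uv] by (simp only: mult_1_right mult_minus_right)
      also have "\<dots> \<in> P"
        by (intro P_add; rule P_mult, rule disjI1, rule a b that)
      finally show ?thesis
        by (rule P_const)
    qed
    then have "P \<subseteq> {g. point_eval (a, b) g = 0}"
      by blast
    moreover have "(a, b) \<in> curve f"
      unfolding mem_curve_iff by (rule P_ev[OF P_dvd[OF dvd_refl]])
    ultimately show ?thesis
      by (intro reduce[of "(a, b)"])
  qed
qed

lemma bij_betw_point_ideal: "bij_betw point_ideal (curve f) (max_spectrum (range_ring E))"
proof -
  have "inj_on point_ideal (curve f)"
  proof (rule inj_onI)
    fix x y
    assume x: "x \<in> curve f" and y: "y \<in> curve f" and "point_ideal x = point_ideal y"
    then have eq: "point_eval x g = 0 \<longleftrightarrow> point_eval y g = 0" for g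
      by (simp flip: E_mem_point_ideal_iff)
    \<comment> \<open>The functions \<lambda> - fst x and \<mu> - snd x vanish at \<open>x\<close>,
      hence at \<open>y\<close>.\<close>
    show "x = y"
      using eq[of "[:[:- fst x, 1:]:]"] eq[of "[:[:- snd x:], 1:]"]
      by (simp add: point_eval_def prod_eq_iff)
  qed
  moreover have "point_ideal ` curve f = max_spectrum (range_ring E)"
    using maximalideal_point_ideal maximalideal_eq_point_ideal unfolding max_spectrum_def by blast
  ultimately show ?thesis
    by (simp add: bij_betw_def)
qed

lemma value_at_point_ideal:
  assumes "x \<in> curve f"
  shows "value_at (range_ring E) (\<lambda>c. E [:[:c:]:]) (point_ideal x) (E g) = point_eval x g"
  by (simp add: value_at_def a_minus_range_ring E_mem_point_ideal_iff[OF assms])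

lemma curve_isomorphic_max_spectrum_range_ring:
  "curve_isomorphic_max_spectrum f (range_ring E) (\<lambda>c. E [:[:c:]:])"
proof -
  let ?S = "range (\<lambda>g. {(a, b) \<in> curve f. poly (poly g [:b:]) a \<noteq> 0})"
  let ?T = "(\<lambda>a. {m \<in> max_spectrum (range_ring E). a \<notin> m}) ` carrier (range_ring E)"
  have S: "?S = range (\<lambda>g. {x \<in> curve f. point_eval x g \<noteq> 0})"
    by (intro arg_cong[where f = range] ext) (auto simp: point_eval_def)
  \<comment> \<open>The nonvanishing locus of 1 is the whole curve; likewise \<open>E 1\<close> lies
    in no maximal ideal.\<close>
  have Union_S: "\<Union>?S = curve f"
    unfolding S by (auto intro!: exI[of _ 1])
  have image: "point_ideal ` curve f = max_spectrum (range_ring E)"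
    using bij_betw_point_ideal by (simp add: bij_betw_def)
  have "E 1 \<notin> m" if "m \<in> max_spectrum (range_ring E)" for m
    using that E_mem_point_ideal_iff[of _ 1] unfolding image[symmetric] by auto
  then have Union_T: "\<Union>?T = max_spectrum (range_ring E)"
    by auto
  have "{m \<in> max_spectrum (range_ring E). E g \<notin> m}
      = point_ideal ` {x \<in> curve f. point_eval x g \<noteq> 0}" for g
    unfolding image[symmetric] using E_mem_point_ideal_iff[of _ g] by blast
  then have "?T = (`) point_ideal ` ?S"
    unfolding S by (simp add: image_image)
  moreover have "bij_betw point_ideal (\<Union>?S) (\<Union>?T)"
    unfolding Union_S Union_T by (rule bij_betw_point_ideal)
  ultimately have "homeomorphic_map (zariski_curve f) (zariski_max_spectrum (range_ring E)) point_ideal"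
    unfolding zariski_curve_def zariski_max_spectrum_def by (intro homeomorphic_map_generated)
  moreover have "(\<lambda>x\<in>curve f. value_at (range_ring E) (\<lambda>c. E [:[:c:]:]) (point_ideal x) (E g))
      = (\<lambda>x\<in>curve f. poly (poly g [:snd x:]) (fst x))" for g
    by (rule restrict_ext) (simp add: value_at_point_ideal point_eval_def)
  ultimately show ?thesis
    unfolding curve_isomorphic_max_spectrum_def by (intro exI[of _ point_ideal]) (simp add: image_image)
qed

end
section \<open>The Burchnall-Chaundy ideal\<close>

lemma gen_algebra_eq: "gen_algebra L B = range_ring (op_eval L B)"
  by (simp add: gen_algebra_def range_ring_def)

text \<open>The commutation of \<open>L\<close> and \<open>B\<close> enters here: \<open>B\<close>
  then commutes with every \<open>c(L)\<close>.\<close>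

lemma poly_evaluation_op_const:
  assumes "L * B = B * L"
  shows "poly_evaluation (poly_eval op_const L) B"
proof
  show "B * poly_eval op_const L p = poly_eval op_const L p * B" for p
    by (rule const_eval.eval_commutes) (simp_all only: op_const_commutes assms)
qed (simp_all add: const_eval.eval_add const_eval.eval_mult const_eval.eval_1)

lemma eval_ring_op_eval: "L * B = B * L \<Longrightarrow> eval_ring (op_eval L B)"
  using poly_evaluation_op_const[of L B] unfolding op_eval_eq
  by (intro eval_ring.intro poly_evaluation.eval_add poly_evaluation.eval_mult poly_evaluation.eval_1)

lemma op_eval_lambda: "L * B = B * L \<Longrightarrow> op_eval L B [:c:] = poly_eval op_const L c"
  unfolding op_eval_eq by (rule poly_evaluation.eval_const[OF poly_evaluation_op_const])

lemma op_eval_const: "L * B = B * L \<Longrightarrow> op_eval L B [:[:c:]:] = op_const c"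
  by (simp only: op_eval_lambda const_eval.eval_const)

text \<open>Factorisation gives \<open>f\<close> as a unit times a power of \<open>p\<close>. The
  unit is a constant, and a root of it of the right order is absorbed into \<open>p\<close>.\<close>

lemma irreducible_curve_imp_power:
  fixes f :: "'c::field_gcd poly poly"
  assumes closed: "\<And>p :: 'c poly. degree p > 0 \<Longrightarrow> \<exists>x. poly p x = 0"
    and "irreducible_curve f"
  shows "\<exists>h \<sigma>. irreducible h \<and> f = h ^ \<sigma>"
proof -
  obtain p where p: "irreducible p" "p dvd f"
    and assoc: "\<And>q. irreducible q \<Longrightarrow> q dvd f \<Longrightarrow> p dvd q"
    using assms(2) unfolding irreducible_curve_def by blast
  have p_dvd: "p dvd g" if g: "g dvd f" "g \<noteq> 0" "\<not> is_unit g" for g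
  proof -
    obtain q where "q dvd g" "prime q"
      using prime_divisor_exists[OF g(2,3)] by blast
    moreover from this have "p dvd q"
      using g(1) by (intro assoc prime_elem_imp_irreducible prime_imp_prime_elem) (auto intro: dvd_trans)
    ultimately show ?thesis
      by (blast intro: dvd_trans)
  qed
  \<comment> \<open>For \<open>f = 0\<close> every irreducible polynomial would be a multiple of
    \<open>p\<close>, in particular \<lambda> and \<mu>, which have no common nonunit
    divisor.\<close>
  have "f \<noteq> 0"
  proof
    assume "f = 0"
    then have "p dvd [:[:0, 1:]:]" "p dvd [:0, 1:]"
      by (auto intro!: p_dvd simp: is_unit_poly_iff is_unit_const_poly_iff)
    then have "degree p = 0"
      using dvd_imp_degree_le[of p "[:[:0, 1:]:]"] by simp
    then obtain e where e: "p = [:e:]"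
      by (metis degree_eq_zeroE)
    then have "e dvd coeff [:0, 1:] 1"
      using \<open>p dvd [:0, 1:]\<close> by (metis const_poly_dvd_iff)
    then have "is_unit p"
      by (simp add: e is_unit_const_poly_iff)
    with p(1) show False
      by (simp add: irreducible_def)
  qed
  moreover have "\<not> is_unit p"
    using p(1) by (simp add: irreducible_def)
  ultimately obtain u where u: "f = p ^ multiplicity p f * u" "\<not> p dvd u"
    by (rule multiplicity_decompose')
  let ?m = "multiplicity p f"
  have "is_unit u"
    using p_dvd[of u] u \<open>f \<noteq> 0\<close> by (metis dvd_triv_right mult_zero_right)
  then obtain d where d: "u = [:[:d:]:]" "d \<noteq> 0"
    by (auto simp: is_unit_poly_iff dvd_field_iff)
  have "?m \<noteq> 0"
    using u p(2) by (metis mult_1 power_0)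
  \<comment> \<open>As the exponent m is positive, x^m - d is nonconstant, and a root
    \<open>e\<close> of it satisfies e^m = d.\<close>
  then have "coeff (monom 1 ?m - [:d:]) ?m = 1"
    by (simp add: coeff_pCons split: nat.split)
  then have "degree (monom 1 ?m - [:d:]) > 0"
    using \<open>?m \<noteq> 0\<close> le_degree[of "monom 1 ?m - [:d:]" ?m] by simp
  then obtain e where "poly (monom 1 ?m - [:d:]) e = 0"
    using closed by blast
  then have e: "e ^ ?m = d"
    by (simp add: poly_monom)
  then have "e \<noteq> 0"
    using d(2) \<open>?m \<noteq> 0\<close> by (auto simp: power_0_left)
  then have "is_unit [:[:e:]:]"
    by (simp add: is_unit_const_poly_iff dvd_field_iff)
  then have "irreducible ([:[:e:]:] * p)"
    using p(1) irreducible_mult_unit_left by blast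
  moreover have "f = ([:[:e:]:] * p) ^ ?m"
    by (subst u(1)) (simp only: d e[symmetric] power_mult_distrib poly_const_pow mult.commute)
  ultimately show ?thesis
    by blast
qed

section \<open>Annihilating polynomials of a commuting pair\<close>

locale commuting_operators =
  fixes L B :: "('a::differential_field, 'n::finite) diff_op" and A0 A1 :: "'a^'n^'n"
  assumes closed: "\<And>p :: 'a constants poly. degree p > 0 \<Longrightarrow> \<exists>x. poly p x = 0"
    and L: "L = op_mat A0 + op_mat A1 * op_D"
    and inv: "invertible A1"
    and comm: "L * B = B * L"
begin

sublocale eval_ring "op_eval L B"
  by (rule eval_ring_op_eval[OF comm])

lemma left_regular: "c \<noteq> 0 \<Longrightarrow> op_eval L B [:c:] * X = 0 \<Longrightarrow> X = 0"
  using poly_order_one_left_regular[OF closed inv L] by (simp add: op_eval_lambda[OF comm])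

text \<open>Supplies the positive degree in \<mu> for elimination: a nonzero
  \<open>h = c(\<lambda>)\<close> has a left regular value, all of whose powers are nonzero.\<close>

lemma degree_pos_if_power_eval_0:
  assumes "h \<noteq> 0" "op_eval L B h ^ s = 0"
  shows "degree h > 0"
proof (rule ccontr)
  assume "\<not> degree h > 0"
  then obtain c where c: "h = [:c:]" "c \<noteq> 0"
    using assms(1) by (metis degree_eq_zeroE gr0I pCons_0_0)
  have "op_eval L B h ^ s \<noteq> 0" for s
    using left_regular[OF c(2)] by (induction s) (auto simp: c(1))
  with assms(2) show False
    by blast
qed

text \<open>
  If \<open>g = h\<^sup>s u\<close> with \<open>h\<close> not dividing \<open>u\<close> and \<open>s < r\<close>, then a combination of \<open>u\<close> and \<open>h\<close> is a nonzero
  \<open>c(\<lambda>)\<close>. Multiplying by \<open>h\<^sup>r\<^sup>-\<^sup>1\<close> and evaluating gives \<open>c(L) h(L,B)\<^sup>r\<^sup>-\<^sup>1 = 0\<close>, and \<open>c(L)\<close> is left regular.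
\<close>

lemma power_dvd_if_eval_0:
  assumes h: "irreducible h" and r: "op_eval L B h ^ r = 0"
    and min: "\<And>s. s < r \<Longrightarrow> op_eval L B h ^ s \<noteq> 0"
    and g: "op_eval L B g = 0"
  shows "h ^ r dvd g"
proof -
  have "h ^ s dvd g" if "s \<le> r" for s
    using that
  proof (induction s)
    case (Suc s)
    then obtain u where u: "g = h ^ s * u"
      by auto
    have "h dvd u"
    proof (rule ccontr)
      assume "\<not> h dvd u"
      moreover have "prime_elem h"
        using h by (rule irreducible_imp_prime_elem)
      moreover have "degree h > 0"
        using h r by (intro degree_pos_if_power_eval_0) (auto simp: irreducible_def)
      ultimately obtain a b c where c: "c \<noteq> 0" "a * u + b * h = [:c:]"
        using prime_elem_combination_const by blast
      obtain k where k: "r = Suc (s + k)"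
        using Suc.prems by (metis less_imp_Suc_add Suc_le_lessD)
      have "[:c:] * h ^ (s + k) = a * h ^ k * g + b * h ^ r"
        unfolding c(2)[symmetric] u k by (simp add: algebra_simps power_add)
      then have "op_eval L B ([:c:] * h ^ (s + k)) = op_eval L B (a * h ^ k * g + b * h ^ r)"
        by (rule arg_cong)
      then have "op_eval L B [:c:] * op_eval L B h ^ (s + k) = 0"
        unfolding E_mult E_add E_power g r by simp
      then have "op_eval L B h ^ (s + k) = 0"
        by (rule left_regular[OF c(1)])
      then show False
        using min[of "s + k"] k by simp
    qed
    then have "h ^ s * h dvd h ^ s * u"
      by simp
    then show ?case
      by (simp add: u mult.commute)
  qed simp
  then show ?thesis
    by blast
qed

lemma BC_structure:
  assumes h: "irreducible h" and \<sigma>: "op_eval L B (h ^ \<sigma>) = 0"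
  shows "\<exists>r. 1 \<le> r \<and> r \<le> \<sigma> \<and> op_eval L B h ^ r = 0 \<and> (\<forall>s<r. op_eval L B h ^ s \<noteq> 0) \<and>
    BC L B = {g. h ^ r dvd g}"
proof -
  define r where "r = (LEAST s. op_eval L B h ^ s = 0)"
  have \<sigma>': "op_eval L B h ^ \<sigma> = 0"
    using \<sigma> by (simp add: E_power)
  then have r: "op_eval L B h ^ r = 0" and "r \<le> \<sigma>"
    unfolding r_def by (rule LeastI, rule Least_le)
  have min: "op_eval L B h ^ s \<noteq> 0" if "s < r" for s
    using that not_less_Least unfolding r_def by blast
  \<comment> \<open>The zeroth power is 1, which is not 0 in the operator ring.\<close>
  have "r \<noteq> 0"
    using r by (intro notI) simp
  moreover have "op_eval L B (h ^ r * k) = 0" for k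
    by (simp add: E_mult E_power r)
  then have "BC L B = {g. h ^ r dvd g}"
    using power_dvd_if_eval_0[OF h r min] unfolding BC_def by (auto elim: dvdE)
  ultimately show ?thesis
    using r \<open>r \<le> \<sigma>\<close> min by (intro exI[of _ r]) simp
qed

end

theorem theorem3:
  fixes L B :: "('a::differential_field, 'n::finite) diff_op"
    and A0 A1 :: "'a^'n^'n"
    and f :: "'a constants poly poly"
  assumes "CHAR('a constants) = 0"
    and "\<forall>p :: 'a constants poly. Polynomial.degree p > 0 \<longrightarrow> (\<exists>x. poly p x = 0)"
    and "L = op_mat A0 + op_mat A1 * op_D"
    and "invertible A1"
    and "L * B = B * L"
    and "map_poly (map_poly of_constant) f = DRes L B"
    and "irreducible_curve f"
    and "op_eval L B f = 0"
  shows "(\<exists>h \<sigma>. Factorial_Ring.irreducible h \<and> f = h ^ \<sigma>) \<and>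
    (\<forall>h \<sigma>. Factorial_Ring.irreducible h \<and> f = h ^ \<sigma> \<longrightarrow>
      (\<exists>r. 1 \<le> r \<and> r \<le> \<sigma> \<and>
        op_eval L B h ^ r = 0 \<and> (\<forall>s. 0 < s \<and> s < r \<longrightarrow> op_eval L B h ^ s \<noteq> 0) \<and>
        BC L B = PIdl\<^bsub>poly_ring2\<^esub> (h ^ r) \<and>
        algebra_isomorphic
          (gen_algebra L B) op_const
          (poly_ring2 Quot PIdl\<^bsub>poly_ring2\<^esub> (h ^ r))
          (\<lambda>c. PIdl\<^bsub>poly_ring2\<^esub> (h ^ r) +>\<^bsub>poly_ring2\<^esub> [:[:c:]:]))) \<and>
    (Factorial_Ring.irreducible f \<longrightarrow>
      domain (gen_algebra L B) \<and>
      curve_isomorphic_max_spectrum f (gen_algebra L B) op_const)"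
proof (intro conjI allI impI)
  interpret commuting_operators L B A0 A1
    by unfold_locales (use assms in auto)
  have const: "op_const = (\<lambda>c. op_eval L B [:[:c:]:])"
    by (simp add: fun_eq_iff op_eval_const[OF assms(5)])
  show "\<exists>h \<sigma>. Factorial_Ring.irreducible h \<and> f = h ^ \<sigma>"
    by (rule irreducible_curve_imp_power[OF closed assms(7)])
  fix h \<sigma>
  assume "Factorial_Ring.irreducible h \<and> f = h ^ \<sigma>"
  then obtain r where r: "1 \<le> r" "r \<le> \<sigma>" "op_eval L B h ^ r = 0" "\<forall>s<r. op_eval L B h ^ s \<noteq> 0"
    and BC: "BC L B = PIdl\<^bsub>poly_ring2\<^esub> (h ^ r)"
    using BC_structure[of h \<sigma>] assms(8) unfolding cgenideal_poly_ring2 by blast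
  have "algebra_isomorphic (gen_algebra L B) op_const
      (poly_ring2 Quot PIdl\<^bsub>poly_ring2\<^esub> (h ^ r))
      (\<lambda>c. PIdl\<^bsub>poly_ring2\<^esub> (h ^ r) +>\<^bsub>poly_ring2\<^esub> [:[:c:]:])"
    unfolding gen_algebra_eq const using BC unfolding BC_def by (rule algebra_isomorphic_quotient)
  with r BC show "\<exists>r. 1 \<le> r \<and> r \<le> \<sigma> \<and>
      op_eval L B h ^ r = 0 \<and> (\<forall>s. 0 < s \<and> s < r \<longrightarrow> op_eval L B h ^ s \<noteq> 0) \<and>
      BC L B = PIdl\<^bsub>poly_ring2\<^esub> (h ^ r) \<and>
      algebra_isomorphic (gen_algebra L B) op_const
        (poly_ring2 Quot PIdl\<^bsub>poly_ring2\<^esub> (h ^ r))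
        (\<lambda>c. PIdl\<^bsub>poly_ring2\<^esub> (h ^ r) +>\<^bsub>poly_ring2\<^esub> [:[:c:]:])"
    by blast
next
  interpret commuting_operators L B A0 A1
    by unfold_locales (use assms in auto)
  have const: "op_const = (\<lambda>c. op_eval L B [:[:c:]:])"
    by (simp add: fun_eq_iff op_eval_const[OF assms(5)])
  assume irr: "Factorial_Ring.irreducible f"
  \<comment> \<open>Taking h = f and \<sigma> = 1 pins r to 1, so the kernel of evaluation is
    \<open>(f)\<close>.\<close>
  obtain r where "1 \<le> r" "r \<le> 1" "BC L B = {g. f ^ r dvd g}"
    using BC_structure[OF irr, of 1] assms(8) by auto
  then have BC: "BC L B = {g. f dvd g}"
    by (simp add: le_antisym)
  interpret coordinate_ring "op_eval L B" f
  proof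
    show "prime_elem f"
      using irr by (rule irreducible_imp_prime_elem)
    show "degree f > 0"
      using irr assms(8) by (intro degree_pos_if_power_eval_0[of f 1]) (auto simp: irreducible_def)
    show "op_eval L B g = 0 \<longleftrightarrow> f dvd g" for g
      using BC by (auto simp: BC_def)
  qed (rule closed)
  show "domain (gen_algebra L B)"
    unfolding gen_algebra_eq by (rule domain_range_ring)
  show "curve_isomorphic_max_spectrum f (gen_algebra L B) op_const"
    unfolding gen_algebra_eq const by (rule curve_isomorphic_max_spectrum_range_ring)
qed

end
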